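(* Let $(A,\ast,\alpha,\beta)$ be a BiHom-alternative algebra, with product written $xy=x\ast y$, and let $R,P:A\to A$ be two commuting Rota-Baxter operators of weight $0$ on $A$ such that $R\alpha=\alpha R$, $R\beta=\beta R$, $P\alpha=\alpha P$ and $P\beta=\beta P$. Then $(A,\nwarrow,\swarrow,\nearrow,\searrow,\alpha,\beta)$ is a BiHom-alternative quadri-algebra on the underlying vector space $A$, with operations defined for all $x,y\in A$ by $$x\searrow y=P(R(x))y=R(P(x))y,\quad x\nearrow y=R(x)P(y),\quad x\swarrow y=P(x)R(y),\quad x\nwarrow y=xR(P(y))=xP(R(y)).$$
   Context: $\mathbb K$ is a field of characteristic $0$; all vector spaces are over $\mathbb K$. A BiHom-alternative algebra is a quadruple $(A,\mu,\alpha,\beta)$ with $A$ a vector space, $\mu:A\times A\to A$ bilinear (written $xy=\mu(x,y)$), $\alpha,\beta:A\to A$ linear with $\alpha\beta=\beta\alpha$, $\alpha(xy)=\alpha(x)\alpha(y)$, $\beta(xy)=\beta(x)\beta(y)$, such that, with $as_{\alpha,\beta}(x,y,z)=\alpha(x)(yz)-(xy)\beta(z)$, for all $x,y,z\in A$: $as_{\alpha,\beta}(\beta(x),\alpha(y),z)+as_{\alpha,\beta}(\beta(y),\alpha(x),z)=0$ and $as_{\alpha,\beta}(x,\beta(y),\alpha(z))+as_{\alpha,\beta}(x,\beta(z),\alpha(y))=0$. A Rota-Baxter operator of weight $0$ on a BiHom-alternative algebra is a linear map $R:A\to A$ with $R(x)R(y)=R(R(x)y+xR(y))$ for all $x,y\in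 A$ (commuting with $\alpha$ and $\beta$). A BiHom-alternative quadri-algebra is a tuple $(A,\nwarrow,\swarrow,\nearrow,\searrow,\alpha,\beta)$ with $A$ a vector space, four bilinear operations $A\times A\to A$, and two commuting linear maps $\alpha,\beta:A\to A$ multiplicative for all four operations, such that, with $\succ,\prec,\vee,\wedge,\star$ defined by $x\succ y=x\nearrow y+x\searrow y$, $x\prec y=x\nwarrow y+x\swarrow y$, $x\vee y=x\searrow y+x\swarrow y$, $x\wedge y=x\nearrow y+x\nwarrow y$, $x\star y=x\searrow y+x\nearrow y+x\swarrow y+x\nwarrow y$, and (dropping subscripts $\alpha,\beta$) $\{x,y,z\}^r=(x\nwarrow y)\nwarrow\beta(z)-\alpha(x)\nwarrow(y\star z)$, $\{x,y,z\}^l=(x\star y)\searrow\beta(z)-\alpha(x)\searrow(y\searrow z)$, $\{x,y,z\}^{ne}=(x\wedge y)\nearrow\beta(z)-\alpha(x)\nearrow(y\succ z)$, $\{x,y,z\}^{sw}=(x\prec y)\swarrow\beta(z)-\alpha(x)\swarrow(y\vee z)$, $\{x,y,z\}^n=(x\nearrow y)\nwarrow\beta(z)-\alpha(x)\nearrow(y\prec z)$, $\{x,y,z\}^w=(x\swarrow y)\nwarrow\beta(z)-\alpha(x)\swarrow(y\wedge z)$, $\{x,y,z\}^s=(x\succ y)\swarrow\beta(z)-\alpha(x)\searrow(y\swarrow z)$, $\{x,y,z\}^e=(x\vee y)\nearrow\beta(z)-\alpha(x)\searrow(y\nearrow z)$, $\{x,y,z\}^m=(x\searrow y)\nwarrow\beta(z)-\alpha(x)\searrow(y\nwarrow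 z)$, for all $x,y,z\in A$: - $\{\beta(x),\alpha(y),z\}^p+\{\beta(y),\alpha(x),z\}^q=0$ for $(p,q)\in\{(r,m),(n,w),(ne,e),(sw,s),(l,l)\}$; - $\{x,\beta(y),\alpha(z)\}^p+\{x,\beta(z),\alpha(y)\}^q=0$ for $(p,q)\in\{(r,r),(n,ne),(w,sw),(m,l),(s,e)\}$. *)

theory Defs
  imports Complex_Main
begin

definition bilinear_op ::
    "('k::field_char_0 \<Rightarrow> 'a::ab_group_add \<Rightarrow> 'a) \<Rightarrow> ('a \<Rightarrow> 'a \<Rightarrow> 'a) \<Rightarrow> bool" where
  "bilinear_op scale f \<longleftrightarrow>
     (\<forall>x. Vector_Spaces.linear scale scale (\<lambda>y. f x y)) \<and>
     (\<forall>y. Vector_Spaces.linear scale scale (\<lambda>x. f x y))"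

definition multiplicative_for :: "('a \<Rightarrow> 'a) \<Rightarrow> ('a \<Rightarrow> 'a \<Rightarrow> 'a) \<Rightarrow> bool" where
  "multiplicative_for \<phi> f \<longleftrightarrow> (\<forall>x y. \<phi> (f x y) = f (\<phi> x) (\<phi> y))"

text \<open>The underlying vector space is the whole type \<open>'a\<close>, with an arbitrary scalar
  multiplication by a field of characteristic \<open>0\<close>.\<close>

locale bihom_algebra = vector_space scale
  for scale :: "'k::field_char_0 \<Rightarrow> 'a::ab_group_add \<Rightarrow> 'a" +
  fixes mult :: "'a \<Rightarrow> 'a \<Rightarrow> 'a" (infixl \<open>\<cdot>\<close> 70)
    and \<alpha> :: "'a \<Rightarrow> 'a"
    and \<beta> :: "'a \<Rightarrow> 'a"
  assumes bilinear: "bilinear_op scale (\<cdot>)"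
    and linear_alpha: "Vector_Spaces.linear scale scale \<alpha>"
    and linear_beta: "Vector_Spaces.linear scale scale \<beta>"
    and alpha_beta: "\<alpha> (\<beta> x) = \<beta> (\<alpha> x)"
    and mult_alpha: "multiplicative_for \<alpha> (\<cdot>)"
    and mult_beta: "multiplicative_for \<beta> (\<cdot>)"
begin

definition associator :: "'a \<Rightarrow> 'a \<Rightarrow> 'a \<Rightarrow> 'a" where
  "associator x y z = \<alpha> x \<cdot> (y \<cdot> z) - (x \<cdot> y) \<cdot> \<beta> z"

end

locale bihom_alternative_algebra = bihom_algebra +
  assumes left_alternative:
      "associator (\<beta> x) (\<alpha> y) z + associator (\<beta> y) (\<alpha> x) z = 0"
    and right_alternative:
      "associator x (\<beta> y) (\<alpha> z) + associator x (\<beta> z) (\<alpha> y) = 0"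

text \<open>Rota-Baxter operators of weight \<open>0\<close>; commuting with both structure maps is part of
  the notion.\<close>

locale rota_baxter_operator = bihom_alternative_algebra scale mult \<alpha> \<beta>
  for scale :: "'k::field_char_0 \<Rightarrow> 'a::ab_group_add \<Rightarrow> 'a"
    and mult :: "'a \<Rightarrow> 'a \<Rightarrow> 'a" (infixl \<open>\<cdot>\<close> 70)
    and \<alpha> :: "'a \<Rightarrow> 'a"
    and \<beta> :: "'a \<Rightarrow> 'a" +
  fixes R :: "'a \<Rightarrow> 'a"
  assumes linear_R: "Vector_Spaces.linear scale scale R"
    and rota_baxter: "R x \<cdot> R y = R (R x \<cdot> y + x \<cdot> R y)"
    and R_alpha: "R (\<alpha> x) = \<alpha> (R x)"
    and R_beta: "R (\<beta> x) = \<beta> (R x)"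

locale bihom_quadri_operations = vector_space scale
  for scale :: "'k::field_char_0 \<Rightarrow> 'a::ab_group_add \<Rightarrow> 'a" +
  fixes nw :: "'a \<Rightarrow> 'a \<Rightarrow> 'a" (infixl \<open>\<nwarrow>\<close> 70)
    and sw :: "'a \<Rightarrow> 'a \<Rightarrow> 'a" (infixl \<open>\<swarrow>\<close> 70)
    and ne :: "'a \<Rightarrow> 'a \<Rightarrow> 'a" (infixl \<open>\<nearrow>\<close> 70)
    and se :: "'a \<Rightarrow> 'a \<Rightarrow> 'a" (infixl \<open>\<searrow>\<close> 70)
    and \<alpha> :: "'a \<Rightarrow> 'a"
    and \<beta> :: "'a \<Rightarrow> 'a"
  assumes bilinear_nw: "bilinear_op scale (\<nwarrow>)"
    and bilinear_sw: "bilinear_op scale (\<swarrow>)"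
    and bilinear_ne: "bilinear_op scale (\<nearrow>)"
    and bilinear_se: "bilinear_op scale (\<searrow>)"
    and linear_alpha: "Vector_Spaces.linear scale scale \<alpha>"
    and linear_beta: "Vector_Spaces.linear scale scale \<beta>"
    and alpha_beta: "\<alpha> (\<beta> x) = \<beta> (\<alpha> x)"
    and mult_alpha_nw: "multiplicative_for \<alpha> (\<nwarrow>)"
    and mult_alpha_sw: "multiplicative_for \<alpha> (\<swarrow>)"
    and mult_alpha_ne: "multiplicative_for \<alpha> (\<nearrow>)"
    and mult_alpha_se: "multiplicative_for \<alpha> (\<searrow>)"
    and mult_beta_nw: "multiplicative_for \<beta> (\<nwarrow>)"
    and mult_beta_sw: "multiplicative_for \<beta> (\<swarrow>)"
    and mult_beta_ne: "multiplicative_for \<beta> (\<nearrow>)"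
    and mult_beta_se: "multiplicative_for \<beta> (\<searrow>)"
begin

definition succ_op :: "'a \<Rightarrow> 'a \<Rightarrow> 'a" (infixl \<open>\<succ>\<close> 70) where
  "x \<succ> y = x \<nearrow> y + x \<searrow> y"

definition prec_op :: "'a \<Rightarrow> 'a \<Rightarrow> 'a" (infixl \<open>\<prec>\<close> 70) where
  "x \<prec> y = x \<nwarrow> y + x \<swarrow> y"

definition vee_op :: "'a \<Rightarrow> 'a \<Rightarrow> 'a" (infixl \<open>\<curlyvee>\<close> 70) where
  "x \<curlyvee> y = x \<searrow> y + x \<swarrow> y"

definition wedge_op :: "'a \<Rightarrow> 'a \<Rightarrow> 'a" (infixl \<open>\<curlywedge>\<close> 70) where
  "x \<curlywedge> y = x \<nearrow> y + x \<nwarrow> y"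

definition star_op :: "'a \<Rightarrow> 'a \<Rightarrow> 'a" (infixl \<open>\<star>\<close> 70) where
  "x \<star> y = x \<searrow> y + x \<nearrow> y + x \<swarrow> y + x \<nwarrow> y"

text \<open>\<open>as_p\<close> renders the bracket \<open>{x, y, z}\<close> with superscript \<open>p\<close>.\<close>

definition as_r :: "'a \<Rightarrow> 'a \<Rightarrow> 'a \<Rightarrow> 'a" where
  "as_r x y z = (x \<nwarrow> y) \<nwarrow> \<beta> z - \<alpha> x \<nwarrow> (y \<star> z)"

definition as_l :: "'a \<Rightarrow> 'a \<Rightarrow> 'a \<Rightarrow> 'a" where
  "as_l x y z = (x \<star> y) \<searrow> \<beta> z - \<alpha> x \<searrow> (y \<searrow> z)"

definition as_ne :: "'a \<Rightarrow> 'a \<Rightarrow> 'a \<Rightarrow> 'a" where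
  "as_ne x y z = (x \<curlywedge> y) \<nearrow> \<beta> z - \<alpha> x \<nearrow> (y \<succ> z)"

definition as_sw :: "'a \<Rightarrow> 'a \<Rightarrow> 'a \<Rightarrow> 'a" where
  "as_sw x y z = (x \<prec> y) \<swarrow> \<beta> z - \<alpha> x \<swarrow> (y \<curlyvee> z)"

definition as_n :: "'a \<Rightarrow> 'a \<Rightarrow> 'a \<Rightarrow> 'a" where
  "as_n x y z = (x \<nearrow> y) \<nwarrow> \<beta> z - \<alpha> x \<nearrow> (y \<prec> z)"

definition as_w :: "'a \<Rightarrow> 'a \<Rightarrow> 'a \<Rightarrow> 'a" where
  "as_w x y z = (x \<swarrow> y) \<nwarrow> \<beta> z - \<alpha> x \<swarrow> (y \<curlywedge> z)"

definition as_s :: "'a \<Rightarrow> 'a \<Rightarrow> 'a \<Rightarrow> 'a" where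
  "as_s x y z = (x \<succ> y) \<swarrow> \<beta> z - \<alpha> x \<searrow> (y \<swarrow> z)"

definition as_e :: "'a \<Rightarrow> 'a \<Rightarrow> 'a \<Rightarrow> 'a" where
  "as_e x y z = (x \<curlyvee> y) \<nearrow> \<beta> z - \<alpha> x \<searrow> (y \<nearrow> z)"

definition as_m :: "'a \<Rightarrow> 'a \<Rightarrow> 'a \<Rightarrow> 'a" where
  "as_m x y z = (x \<searrow> y) \<nwarrow> \<beta> z - \<alpha> x \<searrow> (y \<nwarrow> z)"

end

locale bihom_alternative_quadri_algebra = bihom_quadri_operations +
  assumes left_r_m: "as_r (\<beta> x) (\<alpha> y) z + as_m (\<beta> y) (\<alpha> x) z = 0"
    and left_n_w: "as_n (\<beta> x) (\<alpha> y) z + as_w (\<beta> y) (\<alpha> x) z = 0"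
    and left_ne_e: "as_ne (\<beta> x) (\<alpha> y) z + as_e (\<beta> y) (\<alpha> x) z = 0"
    and left_sw_s: "as_sw (\<beta> x) (\<alpha> y) z + as_s (\<beta> y) (\<alpha> x) z = 0"
    and left_l_l: "as_l (\<beta> x) (\<alpha> y) z + as_l (\<beta> y) (\<alpha> x) z = 0"
    and right_r_r: "as_r x (\<beta> y) (\<alpha> z) + as_r x (\<beta> z) (\<alpha> y) = 0"
    and right_n_ne: "as_n x (\<beta> y) (\<alpha> z) + as_ne x (\<beta> z) (\<alpha> y) = 0"
    and right_w_sw: "as_w x (\<beta> y) (\<alpha> z) + as_sw x (\<beta> z) (\<alpha> y) = 0"
    and right_m_l: "as_m x (\<beta> y) (\<alpha> z) + as_l x (\<beta> z) (\<alpha> y) = 0"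
    and right_s_e: "as_s x (\<beta> y) (\<alpha> z) + as_e x (\<beta> z) (\<alpha> y) = 0"

end

theory Submission imports Defs begin

text \<open>
  Write \<open>S = R P = P R\<close>. The point is that each of the nine brackets of the quadri-algebra
  is, up to sign, a single BiHom-associator whose arguments are images under \<open>1\<close>, \<open>R\<close>, \<open>P\<close> or
  \<open>S\<close>. Whenever a composite product (\<open>\<succ>\<close>, \<open>\<prec>\<close>, \<open>\<curlyvee>\<close>, \<open>\<curlywedge>\<close> or \<open>\<star>\<close>) occurs inside a bracket, the
  outer operation applies exactly that one of \<open>R\<close>, \<open>P\<close>, \<open>S\<close> to it for which the Rota-Baxter
  identities collapse the sum to one product:
  \<open>P (x \<succ> y) = S x \<cdot> P y\<close>, \<open>P (x \<prec> y) = P x \<cdot> S y\<close>, \<open>R (x \<curlyvee> y) = S x \<cdot> R y\<close>,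
  \<open>R (x \<curlywedge> y) = R x \<cdot> S y\<close> and \<open>S (x \<star> y) = S x \<cdot> S y\<close>.

  The operators decorating the three arguments are

  \<^item> \<open>r\<close>: \<open>1, S, S\<close>, \<open>m\<close>: \<open>S, 1, S\<close>, \<open>l\<close>: \<open>S, S, 1\<close>;
  \<^item> \<open>n\<close>: \<open>R, P, S\<close>, \<open>w\<close>: \<open>P, R, S\<close>, \<open>ne\<close>: \<open>R, S, P\<close>;
  \<^item> \<open>e\<close>: \<open>S, R, P\<close>, \<open>sw\<close>: \<open>P, S, R\<close>, \<open>s\<close>: \<open>S, P, R\<close>.

  An axiom relating the brackets \<open>p\<close> and \<open>q\<close> by exchanging two arguments always pairs two
  triples that differ by the same exchange. Since \<open>R\<close> and \<open>P\<close> commute with \<open>\<alpha>\<close> and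
  \<open>\<beta>\<close>, it is therefore an instance of left or right alternativity at decorated arguments.
\<close>

locale commuting_rota_baxter_operators =
  R: rota_baxter_operator scale mult \<alpha> \<beta> R + P: rota_baxter_operator scale mult \<alpha> \<beta> P
  for scale :: "'k::field_char_0 \<Rightarrow> 'a::ab_group_add \<Rightarrow> 'a"
    and mult :: "'a \<Rightarrow> 'a \<Rightarrow> 'a" (infixl \<open>\<cdot>\<close> 70)
    and \<alpha> \<beta> R P :: "'a \<Rightarrow> 'a" +
  assumes R_P: "R (P x) = P (R x)"
begin

definition nw :: "'a \<Rightarrow> 'a \<Rightarrow> 'a" where "nw x y = x \<cdot> R (P y)"
definition sw :: "'a \<Rightarrow> 'a \<Rightarrow> 'a" where "sw x y = P x \<cdot> R y"
definition ne :: "'a \<Rightarrow> 'a \<Rightarrow> 'a" where "ne x y = R x \<cdot> P y"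
definition se :: "'a \<Rightarrow> 'a \<Rightarrow> 'a" where "se x y = P (R x) \<cdot> y"

lemmas op_defs = nw_def sw_def ne_def se_def

lemma P_add: "P (x + y) = P x + P y"
  using P.linear_R by (simp add: Vector_Spaces.linear_iff)

lemma bilinear_op_decorated:
  assumes "Vector_Spaces.linear scale scale f" "Vector_Spaces.linear scale scale g"
  shows "bilinear_op scale (\<lambda>x y. f x \<cdot> g y)"
  using assms R.bilinear by (simp add: bilinear_op_def Vector_Spaces.linear_iff)

sublocale quadri: bihom_quadri_operations scale nw sw ne se \<alpha> \<beta>
proof -
  have ops: "nw = (\<lambda>x y. x \<cdot> R (P y))" "sw = (\<lambda>x y. P x \<cdot> R y)"
    "ne = (\<lambda>x y. R x \<cdot> P y)" "se = (\<lambda>x y. P (R x) \<cdot> y)"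
    by (simp_all add: fun_eq_iff op_defs)
  have lin: "Vector_Spaces.linear scale scale (\<lambda>x. x)"
    "Vector_Spaces.linear scale scale (\<lambda>x. R (P x))"
    "Vector_Spaces.linear scale scale (\<lambda>x. P (R x))"
    using R.linear_R P.linear_R by (simp_all add: Vector_Spaces.linear_iff)
  have bilin: "bilinear_op scale nw" "bilinear_op scale sw"
    "bilinear_op scale ne" "bilinear_op scale se"
    unfolding ops
    by (rule bilinear_op_decorated[OF lin(1) lin(2)] bilinear_op_decorated[OF P.linear_R R.linear_R]
        bilinear_op_decorated[OF R.linear_R P.linear_R] bilinear_op_decorated[OF lin(3) lin(1)])+
  have mult: "multiplicative_for \<phi> nw" "multiplicative_for \<phi> sw"
    "multiplicative_for \<phi> ne" "multiplicative_for \<phi> se"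
    if "multiplicative_for \<phi> (\<cdot>)" "\<And>x. R (\<phi> x) = \<phi> (R x)" "\<And>x. P (\<phi> x) = \<phi> (P x)" for \<phi>
    using that by (simp_all add: multiplicative_for_def op_defs)
  show "bihom_quadri_operations scale nw sw ne se \<alpha> \<beta>"
    by (intro bihom_quadri_operations.intro bihom_quadri_operations_axioms.intro
        R.vector_space_axioms bilin mult R.linear_alpha R.linear_beta R.alpha_beta
        R.mult_alpha R.mult_beta R.R_alpha R.R_beta P.R_alpha P.R_beta)
qed

notation quadri.succ_op (infixl \<open>\<succ>\<close> 70)
  and quadri.prec_op (infixl \<open>\<prec>\<close> 70)
  and quadri.vee_op (infixl \<open>\<curlyvee>\<close> 70)
  and quadri.wedge_op (infixl \<open>\<curlywedge>\<close> 70)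
  and quadri.star_op (infixl \<open>\<star>\<close> 70)

lemma P_succ: "P (x \<succ> y) = P (R x) \<cdot> P y"
  by (simp add: quadri.succ_op_def op_defs P.rota_baxter add.commute)

lemma P_prec: "P (x \<prec> y) = P x \<cdot> P (R y)"
  by (simp add: quadri.prec_op_def op_defs P.rota_baxter R_P add.commute)

lemma R_vee: "R (x \<curlyvee> y) = P (R x) \<cdot> R y"
  using R.rota_baxter[of "P x" y] by (simp add: quadri.vee_op_def op_defs R_P)

lemma R_wedge: "R (x \<curlywedge> y) = R x \<cdot> P (R y)"
  using R.rota_baxter[of x "P y"] by (simp add: quadri.wedge_op_def op_defs R_P)

text \<open>The product \<open>\<star>\<close> is \<open>\<succ>\<close> plus \<open>\<prec>\<close>; applying \<open>P\<close> leaves the two terms of the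
  Rota-Baxter identity of \<open>R\<close> at \<open>P x\<close> and \<open>P y\<close>.\<close>

lemma P_R_star: "P (R (x \<star> y)) = P (R x) \<cdot> P (R y)"
proof -
  have "x \<star> y = x \<succ> y + x \<prec> y"
    by (simp add: quadri.star_op_def quadri.succ_op_def quadri.prec_op_def)
  then have "P (x \<star> y) = R (P x) \<cdot> P y + P x \<cdot> R (P y)"
    by (simp add: P_add P_succ P_prec R_P)
  then have "R (P (x \<star> y)) = R (P x) \<cdot> R (P y)"
    by (simp add: R.rota_baxter)
  then show ?thesis by (simp add: R_P)
qed

lemmas collapse = P_succ P_prec R_vee R_wedge P_R_star

lemmas commute = R_P R.R_alpha R.R_beta P.R_alpha P.R_beta

text \<open>In each bracket the product under the outer operation is either composite, and then
  collapses, or already a plain product of decorated arguments. The sign appears because the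
  brackets subtract the two bracketings in the opposite order to the associator.\<close>

lemma as_r_eq: "quadri.as_r x y z = - R.associator x (P (R y)) (P (R z))"
  by (simp add: quadri.as_r_def R.associator_def nw_def collapse commute)

lemma as_l_eq: "quadri.as_l x y z = - R.associator (P (R x)) (P (R y)) z"
  by (simp add: quadri.as_l_def R.associator_def se_def collapse commute)

lemma as_ne_eq: "quadri.as_ne x y z = - R.associator (R x) (P (R y)) (P z)"
  by (simp add: quadri.as_ne_def R.associator_def ne_def collapse commute)

lemma as_sw_eq: "quadri.as_sw x y z = - R.associator (P x) (P (R y)) (R z)"
  by (simp add: quadri.as_sw_def R.associator_def sw_def collapse commute)

lemma as_n_eq: "quadri.as_n x y z = - R.associator (R x) (P y) (P (R z))"
  by (simp add: quadri.as_n_def R.associator_def ne_def nw_def collapse commute)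

lemma as_w_eq: "quadri.as_w x y z = - R.associator (P x) (R y) (P (R z))"
  by (simp add: quadri.as_w_def R.associator_def sw_def nw_def collapse commute)

lemma as_s_eq: "quadri.as_s x y z = - R.associator (P (R x)) (P y) (R z)"
  by (simp add: quadri.as_s_def R.associator_def se_def sw_def collapse commute)

lemma as_e_eq: "quadri.as_e x y z = - R.associator (P (R x)) (R y) (P z)"
  by (simp add: quadri.as_e_def R.associator_def se_def ne_def collapse commute)

lemma as_m_eq: "quadri.as_m x y z = - R.associator (P (R x)) y (P (R z))"
  by (simp add: quadri.as_m_def R.associator_def se_def nw_def collapse commute)

lemmas bracket_eqs = as_r_eq as_l_eq as_ne_eq as_sw_eq as_n_eq as_w_eq as_s_eq as_e_eq as_m_eq

text \<open>Alternativity is restated with the sign that the brackets carry, so that it closes the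
  quadri-algebra axioms after rewriting.\<close>

lemma associator_left_swap:
  "- R.associator (\<beta> x) (\<alpha> y) z - R.associator (\<beta> y) (\<alpha> x) z = 0"
  using R.left_alternative[of x y z] by (simp add: add_eq_0_iff)

lemma associator_right_swap:
  "- R.associator x (\<beta> y) (\<alpha> z) - R.associator x (\<beta> z) (\<alpha> y) = 0"
  using R.right_alternative[of x y z] by (simp add: add_eq_0_iff)

theorem bihom_alternative_quadri_algebra:
  "bihom_alternative_quadri_algebra scale nw sw ne se \<alpha> \<beta>"
  by unfold_locales
    (simp_all add: bracket_eqs commute associator_left_swap associator_right_swap)

end

theorem corollary2p3:
  fixes scale :: "'k::field_char_0 \<Rightarrow> 'a::ab_group_add \<Rightarrow> 'a"
    and mult :: "'a \<Rightarrow> 'a \<Rightarrow> 'a" (infixl \<open>\<cdot>\<close> 70)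
    and \<alpha> \<beta> R P :: "'a \<Rightarrow> 'a"
    and nw sw ne se :: "'a \<Rightarrow> 'a \<Rightarrow> 'a"
  assumes "bihom_alternative_algebra scale (\<cdot>) \<alpha> \<beta>"
    and "rota_baxter_operator scale (\<cdot>) \<alpha> \<beta> R"
    and "rota_baxter_operator scale (\<cdot>) \<alpha> \<beta> P"
    and "R \<circ> P = P \<circ> R"
    and "R \<circ> \<alpha> = \<alpha> \<circ> R" and "R \<circ> \<beta> = \<beta> \<circ> R"
    and "P \<circ> \<alpha> = \<alpha> \<circ> P" and "P \<circ> \<beta> = \<beta> \<circ> P"
    and se: "\<And>x y. se x y = P (R x) \<cdot> y"
    and ne: "\<And>x y. ne x y = R x \<cdot> P y"
    and sw: "\<And>x y. sw x y = P x \<cdot> R y"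
    and nw: "\<And>x y. nw x y = x \<cdot> R (P y)"
  shows "bihom_alternative_quadri_algebra scale nw sw ne se \<alpha> \<beta> \<and>
         (\<forall>x y. se x y = R (P x) \<cdot> y) \<and> (\<forall>x y. nw x y = x \<cdot> P (R y))"
proof -
  have R_P: "R (P x) = P (R x)" for x
    using \<open>R \<circ> P = P \<circ> R\<close> by (simp add: fun_eq_iff)
  then interpret rb: commuting_rota_baxter_operators scale mult \<alpha> \<beta> R P
    using assms(2,3) by (intro commuting_rota_baxter_operators.intro
        commuting_rota_baxter_operators_axioms.intro)
  have "nw = rb.nw" "sw = rb.sw" "ne = rb.ne" "se = rb.se"
    by (simp_all add: fun_eq_iff rb.op_defs nw sw ne se)
  then show ?thesis
    using rb.bihom_alternative_quadri_algebra by (simp add: rb.op_defs R_P)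
qed

end
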